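(* Let $L$ be a bounded chain and let $n\geqslant 1$. A function $f\colon L^{n}\rightarrow L$ is a polynomial function if and only if it is nondecreasing, weakly $\overline{\mathcal{R}}_f$-min homogeneous, and weakly $\overline{\mathcal{R}}_f$-max homogeneous.
   Context: A bounded chain is a totally ordered set $L$ with least element $0$ and greatest element $1$, viewed as a lattice with $\wedge=\min$, $\vee=\max$. $L^n$ has the componentwise order and operations. A polynomial function $L^n\to L$ is any function obtained by finitely many applications of: (i) for each $i\in\{1,\ldots,n\}$ and $c\in L$, the projection $\mathbf{x}\mapsto x_i$ and the constant function $\mathbf{x}\mapsto c$ are polynomial functions; (ii) if $f,g$ are polynomial functions then so are $f\vee g$ and $f\wedge g$ (pointwise). $f$ is nondecreasing if $\mathbf{a}\leqslant\mathbf{b}$ implies $f(\mathbf{a})\leqslant f(\mathbf{b})$. $\mathcal{R}_f=\{f(\mathbf{x}):\mathbf{x}\in L^n\}$ is the range of $f$, and $\overline{\mathcal{R}}_f$ is its convex hull, i.e. the smallest convex subset of $L$ containing $\mathcal{R}_f$ ($S\subseteq L$ is convex if $a,b\in S$, $c\in L$, $a\leqslant c\leqslant b$ imply $c\in S$). For $c\in L$, $\mathbf{x}\wedge c=(x_1\wedge c,\ldots,x_n\wedge c)$ and $\mathbf{x}\vee c=(x_1\vee c,\ldots,x_n\vee c)$. Let $L_n^{(0,2)}=\{\mathbf{x}\in L^n: |\{x_1,\ldots,x_n\}|\leqslant 2\}$. For nonempty $S\subseteq L$, $f$ is weakly $S$-min homogeneous if $f(\mathbf{x}\wedge c)=f(\mathbf{x})\wedge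 c$ for all $\mathbf{x}\in L_n^{(0,2)}$ and $c\in S$; it is weakly $S$-max homogeneous if $f(\mathbf{x}\vee c)=f(\mathbf{x})\vee c$ for all $\mathbf{x}\in L_n^{(0,2)}$ and $c\in S$. *)

theory Defs
  imports "HOL-Analysis.Cartesian_Euclidean_Space"
begin

inductive lattice_polynomial_function ::
  "('a::{linorder, order_bot, order_top} ^ 'n \<Rightarrow> 'a) \<Rightarrow> bool"
where
  proj: "lattice_polynomial_function (\<lambda>x. x $ i)"
| const: "lattice_polynomial_function (\<lambda>x. c)"
| join: "lattice_polynomial_function f \<Longrightarrow> lattice_polynomial_function g \<Longrightarrow>
    lattice_polynomial_function (\<lambda>x. max (f x) (g x))"
| meet: "lattice_polynomial_function f \<Longrightarrow> lattice_polynomial_function g \<Longrightarrow>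
    lattice_polynomial_function (\<lambda>x. min (f x) (g x))"

text \<open>Convexity with respect to the order; the library's \<open>convex\<close> is about real vector spaces.\<close>

definition order_convex :: "'a::order set \<Rightarrow> bool" where
  "order_convex S \<longleftrightarrow> (\<forall>a\<in>S. \<forall>b\<in>S. \<forall>c. a \<le> c \<and> c \<le> b \<longrightarrow> c \<in> S)"

text \<open>\<open>P hull A\<close> is the intersection of all supersets of \<open>A\<close> satisfying \<open>P\<close>; the lemmas
  below confirm that for \<open>order_convex\<close> it is the least such superset.\<close>

definition range_hull :: "('b \<Rightarrow> 'a::order) \<Rightarrow> 'a set" where
  "range_hull f = order_convex hull (range f)"

lemma order_convex_range_hull: "order_convex (range_hull f)"
  unfolding range_hull_def by (rule hull_in) (simp add: order_convex_def, blast)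

lemma range_subset_range_hull: "range f \<subseteq> range_hull f"
  unfolding range_hull_def by (rule hull_subset)

lemma range_hull_least: "range f \<subseteq> S \<Longrightarrow> order_convex S \<Longrightarrow> range_hull f \<subseteq> S"
  unfolding range_hull_def by (rule hull_minimal)

definition meet_const :: "'a::linorder ^ 'n \<Rightarrow> 'a \<Rightarrow> 'a ^ 'n" where
  "meet_const x c = (\<chi> i. min (x $ i) c)"

definition join_const :: "'a::linorder ^ 'n \<Rightarrow> 'a \<Rightarrow> 'a ^ 'n" where
  "join_const x c = (\<chi> i. max (x $ i) c)"

definition two_valued :: "('a ^ 'n) set" where
  "two_valued = {x. card {x $ i | i. True} \<le> 2}"

text \<open>The next two notions are only meant for nonempty \<open>S\<close>; below, \<open>S\<close> is always
  \<open>range_hull f\<close>, which is never empty.\<close>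

definition weakly_min_homogeneous ::
  "'a::linorder set \<Rightarrow> ('a ^ 'n \<Rightarrow> 'a) \<Rightarrow> bool" where
  "weakly_min_homogeneous S f \<longleftrightarrow>
    (\<forall>x\<in>two_valued. \<forall>c\<in>S. f (meet_const x c) = min (f x) c)"

definition weakly_max_homogeneous ::
  "'a::linorder set \<Rightarrow> ('a ^ 'n \<Rightarrow> 'a) \<Rightarrow> bool" where
  "weakly_max_homogeneous S f \<longleftrightarrow>
    (\<forall>x\<in>two_valued. \<forall>c\<in>S. f (join_const x c) = max (f x) c)"

lemma range_hull_nonempty: "range_hull f \<noteq> {}"
  using range_subset_range_hull[of f] by auto

end

theory Submission
  imports Defs
begin

text \<open>
  \<^bold>\<open>Polynomial functions are homogeneous.\<close>  Truncation at \<open>c\<close>, i.e. \<open>y \<mapsto> y \<and> c\<close> or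
  \<open>y \<mapsto> y \<or> c\<close>, is a lattice homomorphism by distributivity, so a polynomial function respects
  its kernel: \<open>f (x \<and> c) \<and> c = f x \<and> c\<close>, and dually
  (\<open>meet_const_compatible\<close>, \<open>join_const_compatible\<close>).  Homogeneity asks for the same identity
  without the outer truncation on the left, that is, for \<open>f (x \<and> c) \<le> c\<close>.  By monotonicity this
  holds as soon as \<open>f (c,\<dots>,c) \<le> c\<close>; and the dual compatibility, taken at the bottom vector, gives
  \<open>f (c,\<dots>,c) \<or> c = f (0,\<dots>,0) \<or> c\<close>, which equals \<open>c\<close> exactly when \<open>f (0,\<dots>,0) \<le> c\<close>.  Dually, homogeneity for
  joins needs \<open>c \<le> f (1,\<dots>,1)\<close>.  The constants meeting both demands are those in the interval
  from \<open>f (0,\<dots>,0)\<close> to \<open>f (1,\<dots>,1)\<close>, which is the convex hull of the range.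

  \<^bold>\<open>Homogeneous monotone functions are polynomial.\<close>  Such a function is recovered from its values
  on the vectors \<open>e\<^sub>I\<close> with entries in \<open>{0, 1}\<close> by the disjunctive normal form
  \<open>f x = \<Or>\<^sub>I (f e\<^sub>I \<and> \<And>\<^sub>i\<^sub>\<in>\<^sub>I x\<^sub>i)\<close> (\<open>disjunctive_normal_form\<close>), whose right-hand side is visibly
  polynomial.  Each term is a lower bound, because \<open>x\<close> dominates \<open>e\<^sub>I\<close> truncated by the term's
  minimum; the term for \<open>I = {i. f x \<le> x\<^sub>i}\<close> attains the value, because \<open>x\<close> lies below \<open>e\<^sub>I\<close>
  raised to some level strictly below \<open>f x\<close>, unless \<open>f x\<close> is already the least value of \<open>f\<close>.  Homogeneity is used only at the vectors \<open>e\<^sub>I\<close>,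
  which have at most two distinct entries; this is why the weak form of it suffices.
\<close>

section \<open>Vertices and the hull of the range\<close>

definition vertex :: "'n set \<Rightarrow> 'a::{order_bot, order_top} ^ 'n" where
  "vertex I = (\<chi> i. if i \<in> I then top else bot)"

lemma vertex_two_valued:
  "(vertex I :: 'a::{order_bot, order_top} ^ 'n::finite) \<in> two_valued"
proof -
  let ?e = "vertex I :: 'a ^ 'n"
  have "{?e $ i | i. True} \<subseteq> {bot, top}"
    by (auto simp: vertex_def)
  then have "card {?e $ i | i. True} \<le> card {bot, top :: 'a}"
    by (intro card_mono) auto
  also have "\<dots> \<le> 2"
    by (simp add: card_insert_if)
  finally show ?thesis
    by (simp add: two_valued_def)
qed

lemma vertex_empty_le: "vertex {} \<le> x"
  and le_vertex_UNIV: "x \<le> vertex UNIV"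
  by (simp_all add: vertex_def less_eq_vec_def)

lemma range_hull_mono:
  fixes f :: "'a::{linorder, order_bot, order_top} ^ 'n \<Rightarrow> 'a"
  assumes "mono f"
  shows "range_hull f = {f (vertex {})..f (vertex UNIV)}"
proof
  show "range_hull f \<subseteq> {f (vertex {})..f (vertex UNIV)}"
    using monoD[OF assms vertex_empty_le] monoD[OF assms le_vertex_UNIV]
    by (intro range_hull_least) (auto simp: order_convex_def)
  have "f (vertex {}) \<in> range_hull f" "f (vertex UNIV) \<in> range_hull f"
    using range_subset_range_hull[of f] by auto
  then show "{f (vertex {})..f (vertex UNIV)} \<subseteq> range_hull f"
    using order_convex_range_hull[of f] unfolding order_convex_def atLeastAtMost_iff subset_iff by blast
qed

section \<open>Polynomial functions are monotone and homogeneous\<close>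

lemma lattice_polynomial_function_mono:
  assumes "lattice_polynomial_function f"
  shows "mono f"
  using assms
proof induction
  case (proj i)
  show ?case
    by (rule monoI) (simp add: less_eq_vec_def)
next
  case (const c)
  show ?case
    by (rule monoI) simp
next
  case (join f g)
  then show ?case
    by (intro monoI max.mono) (auto dest: monoD)
next
  case (meet f g)
  then show ?case
    by (intro monoI min.mono) (auto dest: monoD)
qed

text \<open>
  Truncation is a lattice endomorphism of the chain, and applying a polynomial function to
  vectors that are equal modulo its kernel gives values that are equal modulo its kernel.
\<close>

lemma meet_const_compatible:
  assumes "lattice_polynomial_function f"
  shows "min (f (meet_const x c)) c = min (f x) c"
  using assms
proof induction
  case (join f g)
  then show ?case
    by (simp add: min_max_distrib1)
next
  case (meet f g)
  then show ?case
    by (metis min.assoc min.left_commute min.idem)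
qed (simp_all add: meet_const_def)

lemma join_const_compatible:
  assumes "lattice_polynomial_function f"
  shows "max (f (join_const x c)) c = max (f x) c"
  using assms
proof induction
  case (join f g)
  then show ?case
    by (metis max.assoc max.left_commute max.idem)
next
  case (meet f g)
  then show ?case
    by (simp add: max_min_distrib1)
qed (simp_all add: join_const_def)

text \<open>
  The two bounds on the diagonal combine with compatibility crosswise: the bound from above
  comes from joins and serves homogeneity for meets, and vice versa.
\<close>

lemma lattice_polynomial_function_diagonal_le:
  fixes f :: "'a::{linorder, order_bot, order_top} ^ 'n::finite \<Rightarrow> 'a"
  assumes "lattice_polynomial_function f" and "f (vertex {}) \<le> c"
  shows "f (\<chi> i. c) \<le> c"
proof -
  have "join_const (vertex {} :: 'a ^ 'n) c = (\<chi> i. c)"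
    by (simp add: join_const_def vertex_def)
  then have "max (f (\<chi> i. c)) c = max (f (vertex {})) c"
    using join_const_compatible[OF assms(1), of "vertex {}" c] by simp
  with assms(2) show ?thesis
    by (simp add: max_absorb2 max_def split: if_splits)
qed

lemma lattice_polynomial_function_diagonal_ge:
  fixes f :: "'a::{linorder, order_bot, order_top} ^ 'n::finite \<Rightarrow> 'a"
  assumes "lattice_polynomial_function f" and "c \<le> f (vertex UNIV)"
  shows "c \<le> f (\<chi> i. c)"
proof -
  have "meet_const (vertex UNIV :: 'a ^ 'n) c = (\<chi> i. c)"
    by (simp add: meet_const_def vertex_def)
  then have "min (f (\<chi> i. c)) c = min (f (vertex UNIV)) c"
    using meet_const_compatible[OF assms(1), of "vertex UNIV" c] by simp
  with assms(2) show ?thesis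
    by (simp add: min_absorb2 min_def split: if_splits)
qed

lemma lattice_polynomial_function_min_homogeneous:
  assumes f: "lattice_polynomial_function f" and "f (vertex {}) \<le> c"
  shows "f (meet_const x c) = min (f x) c"
proof -
  have "meet_const x c \<le> (\<chi> i. c)"
    by (simp add: meet_const_def less_eq_vec_def)
  then have "f (meet_const x c) \<le> f (\<chi> i. c)"
    by (rule monoD[OF lattice_polynomial_function_mono[OF f]])
  also have "\<dots> \<le> c"
    by (rule lattice_polynomial_function_diagonal_le[OF assms])
  finally show ?thesis
    using meet_const_compatible[OF f, of x c] by (simp add: min_absorb1)
qed

lemma lattice_polynomial_function_max_homogeneous:
  assumes f: "lattice_polynomial_function f" and "c \<le> f (vertex UNIV)"
  shows "f (join_const x c) = max (f x) c"
proof -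
  have "c \<le> f (\<chi> i. c)"
    by (rule lattice_polynomial_function_diagonal_ge[OF assms])
  also have "(\<chi> i. c) \<le> join_const x c"
    by (simp add: join_const_def less_eq_vec_def)
  then have "f (\<chi> i. c) \<le> f (join_const x c)"
    by (rule monoD[OF lattice_polynomial_function_mono[OF f]])
  finally show ?thesis
    using join_const_compatible[OF f, of x c] by (simp add: max_absorb1)
qed

section \<open>The disjunctive normal form of a homogeneous function\<close>

text \<open>
  The conjunct \<open>f (vertex I)\<close> is put into the set whose minimum is taken, so that \<open>I = {}\<close>
  needs no convention for an empty minimum.
\<close>

definition dnf_term :: "('a::{linorder, order_bot, order_top} ^ 'n \<Rightarrow> 'a) \<Rightarrow> 'n set \<Rightarrow> 'a ^ 'n \<Rightarrow> 'a"
  where "dnf_term f I x = Min (insert (f (vertex I)) ((\<lambda>i. x $ i) ` I))"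

text \<open>
  The level \<open>m\<close> at which \<open>vertex I\<close> is truncated is the value of the term itself, so that
  homogeneity yields \<open>f (vertex I \<and> m) = m\<close>.  That \<open>m\<close> is admissible fails only if it is
  less than the least value of \<open>f\<close>, and then there is nothing to prove.
\<close>

lemma dnf_term_le:
  fixes f :: "'a::{linorder, order_bot, order_top} ^ 'n::finite \<Rightarrow> 'a"
  assumes "mono f" and hom: "weakly_min_homogeneous (range_hull f) f"
  shows "dnf_term f I x \<le> f x"
proof (cases "f (vertex {}) \<le> dnf_term f I x")
  case True
  define m where "m = dnf_term f I x"
  have m_le: "m \<le> f (vertex I)" "\<And>i. i \<in> I \<Longrightarrow> m \<le> x $ i"
    by (auto simp: m_def dnf_term_def)
  have "f (vertex I) \<le> f (vertex UNIV)"
    by (rule monoD[OF \<open>mono f\<close> le_vertex_UNIV])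
  with m_le(1) True have "m \<in> range_hull f"
    by (simp add: range_hull_mono[OF \<open>mono f\<close>] m_def)
  then have "f (meet_const (vertex I) m) = min (f (vertex I)) m"
    using hom vertex_two_valued unfolding weakly_min_homogeneous_def by blast
  also have "\<dots> = m"
    using m_le(1) by (rule min_absorb2)
  finally have "m = f (meet_const (vertex I) m)" ..
  also have "\<dots> \<le> f x"
    using m_le(2) by (intro monoD[OF \<open>mono f\<close>]) (simp add: less_eq_vec_def meet_const_def vertex_def)
  finally show ?thesis
    by (simp add: m_def)
next
  case False
  then show ?thesis
    using monoD[OF \<open>mono f\<close> vertex_empty_le, of x] by simp
qed

lemma le_dnf_term:
  fixes f :: "'a::{linorder, order_bot, order_top} ^ 'n::finite \<Rightarrow> 'a"
  assumes "mono f" and hom: "weakly_max_homogeneous (range_hull f) f"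
  shows "f x \<le> dnf_term f {i. f x \<le> x $ i} x"
proof -
  define I where "I = {i. f x \<le> x $ i}"
  have "f x \<le> f (vertex I)"
  proof (cases "f x \<le> f (vertex {})")
    case True
    also have "f (vertex {}) \<le> f (vertex I)"
      by (rule monoD[OF \<open>mono f\<close> vertex_empty_le])
    finally show ?thesis .
  next
    case False
    \<comment> \<open>The least admissible level above all entries outside \<open>I\<close>.  It is strictly below \<open>f x\<close>,
      hence the inequality \<open>f x \<le> max (f (vertex I)) c\<close> must be due to its first argument.\<close>
    define c where "c = Max (insert (f (vertex {})) ((\<lambda>i. x $ i) ` (- I)))"
    have "c < f x"
      using False by (auto simp: c_def I_def)
    have "f (vertex {}) \<le> c"
      unfolding c_def by (rule Max_ge) simp_all
    moreover have "c \<le> f (vertex UNIV)"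
      using \<open>c < f x\<close> monoD[OF \<open>mono f\<close> le_vertex_UNIV, of x] by simp
    ultimately have "c \<in> range_hull f"
      by (simp add: range_hull_mono[OF \<open>mono f\<close>])
    have "x $ i \<le> c" if "i \<notin> I" for i
      using that by (simp add: c_def)
    then have "f x \<le> f (join_const (vertex I) c)"
      by (intro monoD[OF \<open>mono f\<close>]) (simp add: less_eq_vec_def join_const_def vertex_def)
    also have "\<dots> = max (f (vertex I)) c"
      using hom vertex_two_valued \<open>c \<in> range_hull f\<close> unfolding weakly_max_homogeneous_def by blast
    finally show ?thesis
      using \<open>c < f x\<close> unfolding le_max_iff_disj by (metis leD)
  qed
  then show ?thesis
    by (auto simp: dnf_term_def I_def)
qed

lemma disjunctive_normal_form:
  fixes f :: "'a::{linorder, order_bot, order_top} ^ 'n::finite \<Rightarrow> 'a"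
  assumes "mono f"
    and "weakly_min_homogeneous (range_hull f) f" and "weakly_max_homogeneous (range_hull f) f"
  shows "f x = Max ((\<lambda>I. dnf_term f I x) ` UNIV)"
proof (rule antisym)
  have "dnf_term f {i. f x \<le> x $ i} x \<le> Max ((\<lambda>I. dnf_term f I x) ` UNIV)"
    by (intro Max_ge) auto
  with le_dnf_term[OF assms(1,3)] show "f x \<le> Max ((\<lambda>I. dnf_term f I x) ` UNIV)"
    by (rule order_trans)
  show "Max ((\<lambda>I. dnf_term f I x) ` UNIV) \<le> f x"
    using dnf_term_le[OF assms(1,2)] by simp
qed

section \<open>The normal form is polynomial\<close>

lemma lattice_polynomial_function_Max:
  assumes "finite S" "S \<noteq> {}" "\<And>s. s \<in> S \<Longrightarrow> lattice_polynomial_function (g s)"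
  shows "lattice_polynomial_function (\<lambda>x. Max ((\<lambda>s. g s x) ` S))"
  using assms
proof (induction S rule: finite_ne_induct)
  case (insert s S)
  then show ?case
    by (simp add: lattice_polynomial_function.join)
qed simp

lemma lattice_polynomial_function_insert_Min:
  assumes "finite S" "lattice_polynomial_function h"
    "\<And>s. s \<in> S \<Longrightarrow> lattice_polynomial_function (g s)"
  shows "lattice_polynomial_function (\<lambda>x. Min (insert (h x) ((\<lambda>s. g s x) ` S)))"
  using assms
proof (induction S)
  case (insert s S)
  have "Min (insert (h x) ((\<lambda>s. g s x) ` insert s S)) =
      min (g s x) (Min (insert (h x) ((\<lambda>s. g s x) ` S)))" for x
    unfolding image_insert insert_commute[of "h x" "g s x"]
    by (rule Min_insert) (simp_all add: insert.hyps)
  moreover have "lattice_polynomial_function (g s)"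
    using insert.prems by simp
  moreover have "lattice_polynomial_function (\<lambda>x. Min (insert (h x) ((\<lambda>s. g s x) ` S)))"
    using insert.prems by (intro insert.IH) simp_all
  ultimately show ?case
    by (simp only: lattice_polynomial_function.meet)
qed simp

lemma lattice_polynomial_function_dnf_term:
  fixes f :: "'a::{linorder, order_bot, order_top} ^ 'n::finite \<Rightarrow> 'a"
  shows "lattice_polynomial_function (dnf_term f I)"
  unfolding dnf_term_def[abs_def]
  by (intro lattice_polynomial_function_insert_Min lattice_polynomial_function.proj
      lattice_polynomial_function.const) simp

theorem theorem11:
  fixes f :: "'a::{linorder, order_bot, order_top} ^ 'n::finite \<Rightarrow> 'a"
  shows "lattice_polynomial_function f \<longleftrightarrow>
    mono f \<and> weakly_min_homogeneous (range_hull f) f \<and> weakly_max_homogeneous (range_hull f) f"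
proof (intro iffI conjI)
  assume f: "lattice_polynomial_function f"
  show mono: "mono f"
    by (rule lattice_polynomial_function_mono[OF f])
  show "weakly_min_homogeneous (range_hull f) f"
    by (simp add: weakly_min_homogeneous_def range_hull_mono[OF mono]
        lattice_polynomial_function_min_homogeneous[OF f])
  show "weakly_max_homogeneous (range_hull f) f"
    by (simp add: weakly_max_homogeneous_def range_hull_mono[OF mono]
        lattice_polynomial_function_max_homogeneous[OF f])
next
  assume hom: "mono f \<and> weakly_min_homogeneous (range_hull f) f \<and>
    weakly_max_homogeneous (range_hull f) f"
  have dnf: "(\<lambda>x. Max ((\<lambda>I. dnf_term f I x) ` UNIV)) = f"
    by (rule ext, rule disjunctive_normal_form[symmetric]) (simp_all add: hom)
  have "lattice_polynomial_function (\<lambda>x. Max ((\<lambda>I. dnf_term f I x) ` UNIV))"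
    by (rule lattice_polynomial_function_Max)
      (simp_all add: lattice_polynomial_function_dnf_term)
  then show "lattice_polynomial_function f"
    by (simp only: dnf)
qed

end
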